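(* Let $G$ be a locally compact abelian group and let $\mu$ be a weakly almost periodic measure on $G$ with Eberlein decomposition $\mu=\mu_{\mathsf{s}}+\mu_0$. Then $\mathbb{X}(\mu_{\mathsf{s}})$ is the unique minimal component of $\mathbb{X}(\mu)$.
   Context: $C_c(G)$: continuous compactly supported functions on $G$; $C_u(G)$: Banach space of bounded uniformly continuous complex functions, sup norm. $\theta_G$ (also $dt$) is Haar measure. Measures are (complex) Radon measures on $G$; the vague topology is the weak-* topology of the duality with $C_c(G)$. $\mu$ is translation bounded if $\sup_{x\in G}|\mu|(x+K)<\infty$ for all compact $K$ ($|\mu|$ the variation). $(c*\mu)(x)=\int_G c(x-t)\,d\mu(t)$; $T^tf(x)=f(x-t)$, $T^t\mu=\delta_t*\mu$. The hull $\mathbb{X}(\mu)$ is the vague closure of $\{T^t\mu:t\in G\}$, a compact space with continuous $G$-action. A minimal component of a dynamical system is a non-empty closed $G$-invariant subset in which every orbit is dense. $f\in C_u(G)$ is Bohr (resp. weakly) almost periodic if $\{T^tf:t\in G\}$ is precompact in the norm (resp. weak) topology of $C_u(G)$. $G$ is assumed to admit Følner sequences: sequences $(A_n)$ of compact sets of positive measure with $\theta_G(A_n\triangle(x+A_n))/\theta_G(A_n)\to0$ for all $x\in G$. Every weakly almost periodic $f$ has a mean $M(f)=\lim_n\frac1{\theta_G(A_n)}\int_{x+A_n}f(t)\,dt$, uniformly in $x\in G$, independent of the Følner sequence; $f$ is null weakly almost periodic if moreover $M(|f|)=0$. A translation bounded measure $\mu$ is strongly, weakly, resp. null weakly almost periodic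 ($\mu\in\mathcal{SAP}(G)$, $\mathcal{WAP}(G)$, $\mathcal{WAP}_0(G)$) if for all $c\in C_c(G)$ the function $c*\mu$ is Bohr, weakly, resp. null weakly almost periodic. One has $\mathcal{WAP}(G)=\mathcal{SAP}(G)\oplus\mathcal{WAP}_0(G)$; the Eberlein decomposition of $\mu\in\mathcal{WAP}(G)$ is the unique decomposition $\mu=\mu_{\mathsf{s}}+\mu_0$ with $\mu_{\mathsf{s}}\in\mathcal{SAP}(G)$, $\mu_0\in\mathcal{WAP}_0(G)$. *)

theory Defs
  imports "HOL-Analysis.Analysis"
begin

text \<open>
  Throughout, \<open>'a\<close> is the group \<open>G\<close>: a Hausdorff abelian topological group, written additively.
  Local compactness is a hypothesis of the theorem.
\<close>

section \<open>Function spaces\<close>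

definition Cc :: "('a::topological_space \<Rightarrow> 'b::real_normed_vector) set" where
  "Cc = {f. continuous_on UNIV f \<and> compact (closure {x. f x \<noteq> 0})}"

text \<open>
  The supremum norm is that of the type of bounded continuous functions; it is
  meaningful for \<open>f \<in> bcontfun\<close> only, in particular on \<open>Cc\<close> and \<open>Cu\<close>.
\<close>

definition sup_norm :: "('a::topological_space \<Rightarrow> complex) \<Rightarrow> real" where
  "sup_norm f = norm (Bcontfun f)"

text \<open>Uniform continuity refers to the group uniformity of \<open>G\<close>.\<close>

definition Cu :: "('a::topological_ab_group_add \<Rightarrow> complex) set" where
  "Cu = {f \<in> bcontfun.
          \<forall>\<epsilon>>0. \<exists>U. open U \<and> 0 \<in> U \<and> (\<forall>x y. x - y \<in> U \<longrightarrow> norm (f x - f y) < \<epsilon>)}"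

definition Cu_norm_topology :: "('a::topological_ab_group_add \<Rightarrow> complex) topology" where
  "Cu_norm_topology = pullback_topology Cu Bcontfun euclidean"

definition Cu_dual :: "(('a::topological_ab_group_add \<Rightarrow> complex) \<Rightarrow> complex) set" where
  "Cu_dual = {\<phi>. (\<forall>f\<in>Cu. \<forall>g\<in>Cu. \<phi> (\<lambda>x. f x + g x) = \<phi> f + \<phi> g) \<and>
                 (\<forall>a. \<forall>f\<in>Cu. \<phi> (\<lambda>x. a * f x) = a * \<phi> f) \<and>
                 (\<exists>B. \<forall>f\<in>Cu. norm (\<phi> f) \<le> B * sup_norm f)}"

definition Cu_weak_topology :: "('a::topological_ab_group_add \<Rightarrow> complex) topology" where
  "Cu_weak_topology =
     topology_generated_by {{f \<in> Cu. \<phi> f \<in> V} | \<phi> V. \<phi> \<in> Cu_dual \<and> open V}"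

section \<open>Radon measures\<close>

text \<open>
  A complex Radon measure on a locally compact space that need not be compact is in general not
  a set function on the whole Borel algebra. As in Bourbaki, it is a linear functional
  \<open>c \<mapsto> \<integral> c d\<mu>\<close> on \<open>Cc\<close> that is bounded, with respect to the supremum norm, on the functions
  supported in any fixed compact set. The functionals are normalised to be \<open>undefined\<close> outside
  \<open>Cc\<close>, so that equality of measures is equality in HOL.
\<close>

definition radon_measures :: "(('a::topological_space \<Rightarrow> complex) \<Rightarrow> complex) set" where
  "radon_measures = {\<mu> \<in> extensional Cc.
     (\<forall>f\<in>Cc. \<forall>g\<in>Cc. \<mu> (\<lambda>x. f x + g x) = \<mu> f + \<mu> g) \<and>
     (\<forall>a. \<forall>f\<in>Cc. \<mu> (\<lambda>x. a * f x) = a * \<mu> f) \<and>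
     (\<forall>K. compact K \<longrightarrow> (\<exists>B. \<forall>f\<in>Cc. closure {x. f x \<noteq> 0} \<subseteq> K \<longrightarrow> norm (\<mu> f) \<le> B * sup_norm f))}"

definition radon_add ::
  "(('a::topological_space \<Rightarrow> complex) \<Rightarrow> complex) \<Rightarrow> (('a \<Rightarrow> complex) \<Rightarrow> complex) \<Rightarrow>
   ('a \<Rightarrow> complex) \<Rightarrow> complex" where
  "radon_add \<mu> \<nu> = (\<lambda>f\<in>Cc. \<mu> f + \<nu> f)"

text \<open>The vague topology is the topology of pointwise convergence on \<open>Cc\<close>.\<close>

definition vague_topology :: "(('a::topological_space \<Rightarrow> complex) \<Rightarrow> complex) topology" where
  "vague_topology = subtopology (product_topology (\<lambda>_. euclidean) Cc) radon_measures"

text \<open>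
  The variation \<open>\<bar>\<mu>\<bar>\<close> is the positive Radon measure with
  \<open>\<bar>\<mu>\<bar>(c) = sup {\<bar>\<mu>(g)\<bar> : g \<in> Cc, \<bar>g\<bar> \<le> c}\<close> for \<open>c \<ge> 0\<close> in \<open>Cc\<close>. Its value on a compact set is
  the infimum of \<open>\<bar>\<mu>\<bar>(c)\<close> over the \<open>c \<in> Cc\<close> that dominate the indicator function of the set.
\<close>

definition variation_integral ::
  "(('a::topological_space \<Rightarrow> complex) \<Rightarrow> complex) \<Rightarrow> ('a \<Rightarrow> real) \<Rightarrow> ennreal" where
  "variation_integral \<mu> c = (SUP g\<in>{g\<in>Cc. \<forall>x. norm (g x) \<le> c x}. ennreal (norm (\<mu> g)))"

definition variation_compact ::
  "(('a::topological_space \<Rightarrow> complex) \<Rightarrow> complex) \<Rightarrow> 'a set \<Rightarrow> ennreal" where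
  "variation_compact \<mu> K = (INF c\<in>{c\<in>Cc. \<forall>x. indicator K x \<le> c x}. variation_integral \<mu> c)"

definition translation_bounded ::
  "(('a::topological_ab_group_add \<Rightarrow> complex) \<Rightarrow> complex) \<Rightarrow> bool" where
  "translation_bounded \<mu> \<longleftrightarrow>
     \<mu> \<in> radon_measures \<and> (\<forall>K. compact K \<longrightarrow> (SUP x. variation_compact \<mu> ((+) x ` K)) < \<infinity>)"

definition conv ::
  "('a::topological_ab_group_add \<Rightarrow> complex) \<Rightarrow> (('a \<Rightarrow> complex) \<Rightarrow> complex) \<Rightarrow> 'a \<Rightarrow> complex" where
  "conv c \<mu> x = \<mu> (\<lambda>t. c (x - t))"

definition translate_fun :: "'a::ab_group_add \<Rightarrow> ('a \<Rightarrow> complex) \<Rightarrow> 'a \<Rightarrow> complex" where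
  "translate_fun t f = (\<lambda>x. f (x - t))"

text \<open>\<open>(\<delta>\<^sub>t * \<mu>)(f) = \<integral> \<integral> f (u + s) d\<delta>\<^sub>t(u) d\<mu>(s) = \<integral> f (t + s) d\<mu>(s)\<close>.\<close>

definition translate_measure ::
  "'a::topological_ab_group_add \<Rightarrow> (('a \<Rightarrow> complex) \<Rightarrow> complex) \<Rightarrow> ('a \<Rightarrow> complex) \<Rightarrow> complex" where
  "translate_measure t \<mu> = (\<lambda>f\<in>Cc. \<mu> (\<lambda>s. f (t + s)))"

section \<open>Haar measure, Foelner sequences and means\<close>

definition haar_measure :: "'a::topological_ab_group_add measure \<Rightarrow> bool" where
  "haar_measure \<theta> \<longleftrightarrow>
     sets \<theta> = sets borel \<and>
     emeasure \<theta> UNIV \<noteq> 0 \<and>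
     (\<forall>K. compact K \<longrightarrow> emeasure \<theta> K < \<infinity>) \<and>
     (\<forall>B\<in>sets borel. emeasure \<theta> B = (INF U\<in>{U. open U \<and> B \<subseteq> U}. emeasure \<theta> U)) \<and>
     (\<forall>U. open U \<longrightarrow> emeasure \<theta> U = (SUP K\<in>{K. compact K \<and> K \<subseteq> U}. emeasure \<theta> K)) \<and>
     (\<forall>x. \<forall>B\<in>sets borel. emeasure \<theta> ((+) x ` B) = emeasure \<theta> B)"

definition folner :: "'a::topological_ab_group_add measure \<Rightarrow> (nat \<Rightarrow> 'a set) \<Rightarrow> bool" where
  "folner \<theta> A \<longleftrightarrow>
     (\<forall>n. compact (A n) \<and> measure \<theta> (A n) > 0) \<and>
     (\<forall>x. (\<lambda>n. measure \<theta> (sym_diff (A n) ((+) x ` A n)) / measure \<theta> (A n)) \<longlonglongrightarrow> 0)"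

text \<open>
  \<open>has_mean \<theta> f m\<close> says that \<open>M(f)\<close> exists, uniformly in the translation and for all Foelner
  sequences, and equals \<open>m\<close>. It carries information only if Foelner sequences exist.
\<close>

definition has_mean ::
  "'a::topological_ab_group_add measure \<Rightarrow> ('a \<Rightarrow> complex) \<Rightarrow> complex \<Rightarrow> bool" where
  "has_mean \<theta> f m \<longleftrightarrow>
     (\<forall>A. folner \<theta> A \<longrightarrow>
        uniform_limit UNIV
          (\<lambda>n x. set_lebesgue_integral \<theta> ((+) x ` A n) f / complex_of_real (measure \<theta> (A n)))
          (\<lambda>_. m) sequentially)"

section \<open>Almost periodicity\<close>

text \<open>Precompact means relatively compact, also for the weak topology.\<close>

definition precompactin :: "'b topology \<Rightarrow> 'b set \<Rightarrow> bool" where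
  "precompactin X S \<longleftrightarrow> S \<subseteq> topspace X \<and> compactin X (X closure_of S)"

definition bohr_ap :: "('a::topological_ab_group_add \<Rightarrow> complex) \<Rightarrow> bool" where
  "bohr_ap f \<longleftrightarrow> f \<in> Cu \<and> precompactin Cu_norm_topology (range (\<lambda>t. translate_fun t f))"

definition weakly_ap :: "('a::topological_ab_group_add \<Rightarrow> complex) \<Rightarrow> bool" where
  "weakly_ap f \<longleftrightarrow> f \<in> Cu \<and> precompactin Cu_weak_topology (range (\<lambda>t. translate_fun t f))"

definition null_weakly_ap ::
  "'a::topological_ab_group_add measure \<Rightarrow> ('a \<Rightarrow> complex) \<Rightarrow> bool" where
  "null_weakly_ap \<theta> f \<longleftrightarrow> weakly_ap f \<and> has_mean \<theta> (\<lambda>x. complex_of_real (norm (f x))) 0"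

definition SAP :: "(('a::topological_ab_group_add \<Rightarrow> complex) \<Rightarrow> complex) set" where
  "SAP = {\<mu>. translation_bounded \<mu> \<and> (\<forall>c\<in>Cc. bohr_ap (conv c \<mu>))}"

definition WAP :: "(('a::topological_ab_group_add \<Rightarrow> complex) \<Rightarrow> complex) set" where
  "WAP = {\<mu>. translation_bounded \<mu> \<and> (\<forall>c\<in>Cc. weakly_ap (conv c \<mu>))}"

definition WAP0 ::
  "'a::topological_ab_group_add measure \<Rightarrow> (('a \<Rightarrow> complex) \<Rightarrow> complex) set" where
  "WAP0 \<theta> = {\<mu>. translation_bounded \<mu> \<and> (\<forall>c\<in>Cc. null_weakly_ap \<theta> (conv c \<mu>))}"

definition eberlein_decomposition ::
  "'a::topological_ab_group_add measure \<Rightarrow> (('a \<Rightarrow> complex) \<Rightarrow> complex) \<Rightarrow>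
   (('a \<Rightarrow> complex) \<Rightarrow> complex) \<Rightarrow> (('a \<Rightarrow> complex) \<Rightarrow> complex) \<Rightarrow> bool" where
  "eberlein_decomposition \<theta> \<mu> \<mu>\<^sub>s \<mu>\<^sub>0 \<longleftrightarrow> \<mu>\<^sub>s \<in> SAP \<and> \<mu>\<^sub>0 \<in> WAP0 \<theta> \<and> \<mu> = radon_add \<mu>\<^sub>s \<mu>\<^sub>0"

section \<open>Hulls and minimal components\<close>

definition hull_of ::
  "(('a::topological_ab_group_add \<Rightarrow> complex) \<Rightarrow> complex) \<Rightarrow> (('a \<Rightarrow> complex) \<Rightarrow> complex) set" where
  "hull_of \<mu> = vague_topology closure_of (range (\<lambda>t. translate_measure t \<mu>))"

definition minimal_component :: "'b topology \<Rightarrow> ('a \<Rightarrow> 'b \<Rightarrow> 'b) \<Rightarrow> 'b set \<Rightarrow> bool" where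
  "minimal_component X \<alpha> Y \<longleftrightarrow>
     Y \<noteq> {} \<and> closedin X Y \<and> (\<forall>t. \<forall>y\<in>Y. \<alpha> t y \<in> Y) \<and>
     (\<forall>y\<in>Y. subtopology X Y closure_of (range (\<lambda>t. \<alpha> t y)) = Y)"

end

theory Submission
  imports Defs
begin

text \<open>
  The idea is a syndeticity statement: for finitely many test functions \<open>f\<close> and \<open>\<epsilon> > 0\<close>, finitely
  many translates of \<open>{t. \<forall>f. \<bar>T\<^sup>t\<mu>(f) - \<mu>\<^sub>s(f)\<bar> < \<epsilon>}\<close> cover \<open>G\<close>. Almost periodicity gives a finite
  set \<open>E\<close> such that every \<open>t + E\<close> contains an \<open>\<epsilon>\<close>-almost period of the strongly almost periodic
  part. As the absolute value of the null part has mean zero uniformly in the translation, every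
  \<open>x + A\<^sub>n\<close> with \<open>n\<close> large contains a point \<open>t\<close> such that the null part is small on all of \<open>t + E\<close>.
  Uniform continuity allows one to replace the compact set \<open>A\<^sub>n\<close> by a finite one. Syndeticity passes
  to vague limits of translates of \<open>\<mu>\<close>, so that \<open>\<mu>\<^sub>s\<close> lies in the closure of every orbit in the
  hull of \<open>\<mu>\<close>, hence \<open>X(\<mu>\<^sub>s)\<close> is contained in every non-empty closed invariant subset.
\<close>

section \<open>Translation of measures and the vague topology\<close>

text \<open>With \<open>h\<close> a homeomorphism and \<open>k\<close> its inverse, the support is
  carried into a compact, hence closed, image under \<open>k\<close>. Translations and reflections
  are both instances. The inclusion of supports is recorded because the bounds of a Radon measure
  depend on the compact set carrying the support.\<close>

lemma Cc_reflect_translate: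
  fixes f :: "'a::{topological_ab_group_add, t2_space} \<Rightarrow> 'b::real_normed_vector"
    and h k :: "'a \<Rightarrow> 'a"
  assumes "f \<in> Cc"
    and cont: "continuous_on UNIV h" "continuous_on UNIV k"
    and inv: "\<And>x. h (k x) = x" "\<And>x. k (h x) = x"
  shows "(\<lambda>s. f (h s)) \<in> Cc" and "closure {s. f (h s) \<noteq> 0} \<subseteq> k ` closure {s. f s \<noteq> 0}"
proof -
  have f: "continuous_on UNIV f" "compact (closure {s. f s \<noteq> 0})"
    using assms(1) by (auto simp: Cc_def)
  have cpt: "compact (k ` closure {s. f s \<noteq> 0})"
    using compact_continuous_image continuous_on_subset cont(2) f(2) by blast
  have "{s. f (h s) \<noteq> 0} \<subseteq> k ` {s. f s \<noteq> 0}"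
    using inv by (auto intro!: image_eqI[of _ k])
  then have "{s. f (h s) \<noteq> 0} \<subseteq> k ` closure {s. f s \<noteq> 0}"
    using image_mono[OF closure_subset] by (rule order_trans)
  then show sub: "closure {s. f (h s) \<noteq> 0} \<subseteq> k ` closure {s. f s \<noteq> 0}"
    using compact_imp_closed[OF cpt] by (rule closure_minimal)
  have "compact (closure {s. f (h s) \<noteq> 0})"
    using compact_Int_closed[OF cpt closed_closure[of "{s. f (h s) \<noteq> 0}"]] sub
    by (simp add: Int_absorb1)
  moreover have "continuous_on UNIV (\<lambda>s. f (h s))"
    using continuous_on_compose2[OF f(1) cont(1)] by simp
  ultimately show "(\<lambda>s. f (h s)) \<in> Cc"
    by (simp add: Cc_def)
qed

lemma Cc_translate:
  fixes f :: "'a::{topological_ab_group_add, t2_space} \<Rightarrow> complex"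
  assumes "f \<in> Cc"
  shows "(\<lambda>s. f (t + s)) \<in> Cc"
    and "closure {s. f (t + s) \<noteq> 0} \<subseteq> (+) (- t) ` closure {s. f s \<noteq> 0}"
proof -
  have "(\<lambda>s. f (t + s)) \<in> Cc \<and> closure {s. f (t + s) \<noteq> 0} \<subseteq> (+) (- t) ` closure {s. f s \<noteq> 0}"
    by (intro conjI Cc_reflect_translate[OF assms, where k = "(+) (- t)"] continuous_intros)
      (simp_all add: add.assoc[symmetric])
  then show "(\<lambda>s. f (t + s)) \<in> Cc"
    and "closure {s. f (t + s) \<noteq> 0} \<subseteq> (+) (- t) ` closure {s. f s \<noteq> 0}"
    by auto
qed

lemma Cc_reflect:
  fixes f :: "'a::{topological_ab_group_add, t2_space} \<Rightarrow> complex"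
  assumes "f \<in> Cc"
  shows "(\<lambda>s. f (x - s)) \<in> Cc"
  by (rule Cc_reflect_translate(1)[OF assms, where k = "\<lambda>s. x - s"])
    (auto intro!: continuous_intros)

text \<open>\<open>apply_bcontfun\<close> inverts \<open>Bcontfun\<close> only on
  \<open>bcontfun\<close>, so membership there is what makes \<open>sup_norm\<close> computable on
  test functions.\<close>

lemma Cc_imp_bcontfun:
  fixes f :: "'a::topological_space \<Rightarrow> complex"
  assumes "f \<in> Cc"
  shows "f \<in> bcontfun"
proof -
  have f: "continuous_on UNIV f" "compact (closure {s. f s \<noteq> 0})"
    using assms by (auto simp: Cc_def)
  have "bounded (insert 0 (f ` closure {s. f s \<noteq> 0}))"
    using compact_continuous_image[OF continuous_on_subset[OF f(1)] f(2)] compact_imp_bounded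
    by (simp add: bounded_insert)
  moreover have "range f \<subseteq> insert 0 (f ` closure {s. f s \<noteq> 0})"
    using closure_subset[of "{s. f s \<noteq> 0}"] by auto
  ultimately have "bounded (range f)"
    by (rule bounded_subset)
  then show ?thesis
    using f(1) by (simp add: bcontfun_def)
qed

lemma sup_norm_translate:
  fixes f :: "'a::{topological_ab_group_add, t2_space} \<Rightarrow> complex"
  assumes "f \<in> Cc"
  shows "sup_norm (\<lambda>s. f (t + s)) = sup_norm f"
proof -
  have 1: "apply_bcontfun (Bcontfun f) = f"
    using Cc_imp_bcontfun[OF assms] by (rule Bcontfun_inverse)
  have 2: "apply_bcontfun (Bcontfun (\<lambda>s. f (t + s))) = (\<lambda>s. f (t + s))"
    using Cc_imp_bcontfun[OF Cc_translate(1)[OF assms]] by (rule Bcontfun_inverse)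
  have "range (\<lambda>s. norm (f (t + s))) = (\<lambda>s. norm (f s)) ` range ((+) t)"
    by (simp only: image_image)
  also have "\<dots> = range (\<lambda>s. norm (f s))"
    by simp
  finally show ?thesis
    unfolding sup_norm_def norm_bcontfun_def dist_bcontfun_def by (simp add: 1 2)
qed

lemma translate_measure_apply:
  "f \<in> Cc \<Longrightarrow> translate_measure t \<mu> f = \<mu> (\<lambda>s. f (t + s))"
  by (simp add: translate_measure_def)

lemma translate_measure_radon:
  fixes \<mu> :: "('a::{topological_ab_group_add, t2_space} \<Rightarrow> complex) \<Rightarrow> complex"
  assumes \<mu>: "\<mu> \<in> radon_measures"
  shows "translate_measure t \<mu> \<in> radon_measures"
proof -
  let ?T = "\<lambda>f s. f (t + s)"
  have add: "\<mu> (\<lambda>x. f x + g x) = \<mu> f + \<mu> g" if "f \<in> Cc" "g \<in> Cc" for f g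
    using \<mu> that by (auto simp: radon_measures_def)
  have scale: "\<mu> (\<lambda>x. a * f x) = a * \<mu> f" if "f \<in> Cc" for a f
    using \<mu> that by (auto simp: radon_measures_def)
  have Cc_add: "(\<lambda>x. f x + g x) \<in> Cc" if f: "f \<in> Cc" and g: "g \<in> Cc" for f g :: "'a \<Rightarrow> complex"
  proof -
    have c: "compact (closure {x. f x \<noteq> 0} \<union> closure {x. g x \<noteq> 0})"
      using f g by (auto simp: Cc_def)
    have "closure {x. f x + g x \<noteq> 0} \<subseteq> closure ({x. f x \<noteq> 0} \<union> {x. g x \<noteq> 0})"
      by (intro closure_mono) auto
    then have "compact (closure {x. f x + g x \<noteq> 0})"
      using compact_Int_closed[OF c closed_closure[of "{x. f x + g x \<noteq> 0}"]]
      by (simp add: Int_absorb1)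
    then show ?thesis
      using f g by (auto simp: Cc_def intro!: continuous_intros)
  qed
  have Cc_scale: "(\<lambda>x. a * f x) \<in> Cc" if f: "f \<in> Cc" for f :: "'a \<Rightarrow> complex" and a
  proof -
    have c: "compact (closure {x. f x \<noteq> 0})"
      using f by (auto simp: Cc_def)
    have "closure {x. a * f x \<noteq> 0} \<subseteq> closure {x. f x \<noteq> 0}"
      by (intro closure_mono) auto
    then have "compact (closure {x. a * f x \<noteq> 0})"
      using compact_Int_closed[OF c closed_closure[of "{x. a * f x \<noteq> 0}"]]
      by (simp add: Int_absorb1)
    then show ?thesis
      using f by (auto simp: Cc_def intro!: continuous_intros)
  qed
  have bound: "\<exists>B. \<forall>f\<in>Cc. closure {x. f x \<noteq> 0} \<subseteq> K \<longrightarrow>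
      norm (translate_measure t \<mu> f) \<le> B * sup_norm f" if "compact K" for K
  proof -
    \<comment> \<open>A function supported in \<open>K\<close>, precomposed with
      \<open>s \<mapsto> t + s\<close>, is supported in the translate of \<open>K\<close> by
      \<open>- t\<close> and keeps its sup norm. So the bound of \<open>\<mu>\<close> for that
      compact set serves for \<open>K\<close>.\<close>
    have "compact ((+) (- t) ` K)"
      by (rule compact_continuous_image[OF _ that]) (intro continuous_intros)
    then have "\<exists>B. \<forall>f\<in>Cc. closure {x. f x \<noteq> 0} \<subseteq> (+) (- t) ` K \<longrightarrow> norm (\<mu> f) \<le> B * sup_norm f"
      using \<mu> by (simp only: radon_measures_def mem_Collect_eq)
    then obtain B where B: "\<And>f. f \<in> Cc \<Longrightarrow> closure {x. f x \<noteq> 0} \<subseteq> (+) (- t) ` K \<Longrightarrow>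
        norm (\<mu> f) \<le> B * sup_norm f"
      by metis
    have "norm (translate_measure t \<mu> f) \<le> B * sup_norm f"
      if f: "f \<in> Cc" and K: "closure {x. f x \<noteq> 0} \<subseteq> K" for f
    proof -
      have "closure {x. f (t + x) \<noteq> 0} \<subseteq> (+) (- t) ` K"
        using Cc_translate(2)[OF f] K by blast
      from B[OF Cc_translate(1)[OF f] this] show ?thesis
        by (simp add: translate_measure_apply f sup_norm_translate)
    qed
    then show ?thesis by blast
  qed
  have "translate_measure t \<mu> \<in> extensional Cc"
    by (simp add: translate_measure_def)
  moreover have "translate_measure t \<mu> (\<lambda>x. f x + g x) = translate_measure t \<mu> f + translate_measure t \<mu> g"
    if "f \<in> Cc" "g \<in> Cc" for f g
    using that add[OF Cc_translate(1) Cc_translate(1), of f g t t]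
    by (simp add: translate_measure_apply Cc_add)
  moreover have "translate_measure t \<mu> (\<lambda>x. a * f x) = a * translate_measure t \<mu> f"
    if "f \<in> Cc" for a f
    using that scale[OF Cc_translate(1), of f a t]
    by (simp add: translate_measure_apply Cc_scale)
  ultimately show ?thesis
    using bound by (simp only: radon_measures_def mem_Collect_eq) simp
qed

lemma translate_measure_add:
  fixes \<mu> :: "('a::{topological_ab_group_add, t2_space} \<Rightarrow> complex) \<Rightarrow> complex"
  shows "translate_measure s (translate_measure t \<mu>) = translate_measure (s + t) \<mu>"
  by (auto simp: translate_measure_def fun_eq_iff Cc_translate add.assoc restrict_def)

lemma translate_measure_0:
  fixes \<mu> :: "('a::topological_ab_group_add \<Rightarrow> complex) \<Rightarrow> complex"
  assumes "\<mu> \<in> radon_measures"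
  shows "translate_measure 0 \<mu> = \<mu>"
  using assms by (auto simp: translate_measure_def radon_measures_def extensional_restrict)

section \<open>Neighbourhoods in the vague topology\<close>

text \<open>The normalisation to \<open>undefined\<close> outside \<open>Cc\<close> places every
  Radon measure in the product space, so passing to the subtopology loses none of them.\<close>

lemma topspace_vague: "topspace vague_topology = radon_measures"
  unfolding vague_topology_def by (auto simp: radon_measures_def PiE_def)

text \<open>A basic open set of the product restricts only finitely many coordinates, and finitely
  many radii have a common positive lower bound. This reduces membership in a hull to estimates on
  finitely many test functions.\<close>

lemma in_vague_closure_iff:
  fixes \<sigma> :: "('a::topological_space \<Rightarrow> complex) \<Rightarrow> complex"
  assumes \<sigma>: "\<sigma> \<in> radon_measures" and S: "S \<subseteq> radon_measures"
  shows "\<sigma> \<in> vague_topology closure_of S \<longleftrightarrow>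
    (\<forall>F \<epsilon>. finite F \<longrightarrow> F \<subseteq> Cc \<longrightarrow> \<epsilon> > 0 \<longrightarrow> (\<exists>\<rho>\<in>S. \<forall>f\<in>F. norm (\<rho> f - \<sigma> f) < \<epsilon>))"
    (is "?L \<longleftrightarrow> ?R")
proof
  assume L: ?L
  show ?R
  proof (intro allI impI)
    fix F :: "('a \<Rightarrow> complex) set" and \<epsilon> :: real
    assume F: "finite F" "F \<subseteq> Cc" and "\<epsilon> > 0"
    define V where "V = (\<Pi>\<^sub>E f\<in>Cc. if f \<in> F then ball (\<sigma> f) \<epsilon> else (UNIV :: complex set))"
    have "openin (product_topology (\<lambda>_. euclidean) Cc) V"
      unfolding V_def openin_PiE_gen using F by (auto intro: finite_subset)
    then have "openin vague_topology (V \<inter> radon_measures)"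
      unfolding vague_topology_def openin_subtopology by blast
    moreover have "\<sigma> \<in> V \<inter> radon_measures"
      using \<sigma> \<open>\<epsilon> > 0\<close> by (simp add: V_def radon_measures_def PiE_def)
    ultimately obtain \<rho> where "\<rho> \<in> S" "\<rho> \<in> V"
      using L unfolding in_closure_of by blast
    moreover from this have "norm (\<rho> f - \<sigma> f) < \<epsilon>" if "f \<in> F" for f
    proof -
      have "\<rho> f \<in> ball (\<sigma> f) \<epsilon>"
        using PiE_mem[OF \<open>\<rho> \<in> V\<close>[unfolded V_def], of f] that F(2) by auto
      then show ?thesis
        by (simp add: dist_norm norm_minus_commute)
    qed
    ultimately show "\<exists>\<rho>\<in>S. \<forall>f\<in>F. norm (\<rho> f - \<sigma> f) < \<epsilon>"
      by blast
  qed
next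
  assume R: ?R
  show ?L
    unfolding in_closure_of
  proof (intro conjI allI impI)
    show "\<sigma> \<in> topspace vague_topology"
      using \<sigma> by (simp add: topspace_vague)
    fix T assume "\<sigma> \<in> T \<and> openin vague_topology T"
    then obtain W where W: "openin (product_topology (\<lambda>_. euclidean) Cc) W"
        "T = W \<inter> radon_measures" "\<sigma> \<in> W"
      unfolding vague_topology_def openin_subtopology by blast
    then obtain U where U: "finite {f \<in> Cc. U f \<noteq> UNIV}"
        "\<And>f. f \<in> Cc \<Longrightarrow> open (U f)" "\<sigma> \<in> Pi\<^sub>E Cc U" "Pi\<^sub>E Cc U \<subseteq> W"
      unfolding openin_product_topology_alt by force
    define F where "F = {f \<in> Cc. U f \<noteq> UNIV}"
    have "\<forall>f\<in>F. \<exists>e>0. ball (\<sigma> f) e \<subseteq> U f"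
      using U by (auto simp: F_def PiE_def Pi_def open_contains_ball)
    then obtain e where e: "\<And>f. f \<in> F \<Longrightarrow> e f > 0 \<and> ball (\<sigma> f) (e f) \<subseteq> U f"
      by metis
    \<comment> \<open>The inserted 1 keeps the minimum well defined when no coordinate is
      restricted.\<close>
    define \<epsilon> where "\<epsilon> = Min (insert 1 (e ` F))"
    have fin: "finite F" using U(1) by (simp add: F_def)
    have "\<epsilon> > 0" using fin e by (simp add: \<epsilon>_def)
    then obtain \<rho> where \<rho>: "\<rho> \<in> S" "\<forall>f\<in>F. norm (\<rho> f - \<sigma> f) < \<epsilon>"
      using R[rule_format, of F \<epsilon>] fin by (auto simp: F_def)
    have "\<rho> f \<in> U f" if "f \<in> Cc" for f
    proof (cases "f \<in> F")
      case True
      then have "\<epsilon> \<le> e f" using fin by (simp add: \<epsilon>_def)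
      then have "\<rho> f \<in> ball (\<sigma> f) (e f)"
        using \<rho>(2) True by (force simp: dist_norm norm_minus_commute)
      then show ?thesis using e[OF True] by blast
    qed (use that in \<open>simp add: F_def\<close>)
    then have "\<rho> \<in> Pi\<^sub>E Cc U"
      using \<rho>(1) S by (auto simp: radon_measures_def PiE_def)
    then show "\<exists>y. y \<in> S \<and> y \<in> T"
      using U(4) W(2) \<rho>(1) S by blast
  qed
qed

section \<open>Hulls and their invariance\<close>

lemma orbit_subset_radon:
  fixes \<mu> :: "('a::{topological_ab_group_add, t2_space} \<Rightarrow> complex) \<Rightarrow> complex"
  assumes "\<mu> \<in> radon_measures"
  shows "range (\<lambda>t. translate_measure t \<mu>) \<subseteq> radon_measures"
  using translate_measure_radon[OF assms] by blast

lemma hull_subset_radon: "hull_of \<mu> \<subseteq> radon_measures"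
  unfolding hull_of_def topspace_vague[symmetric] by (rule closure_of_subset_topspace)

lemma closedin_hull: "closedin vague_topology (hull_of \<mu>)"
  by (simp add: hull_of_def)

lemma translate_mem_hull:
  fixes \<mu> :: "('a::{topological_ab_group_add, t2_space} \<Rightarrow> complex) \<Rightarrow> complex"
  assumes "\<mu> \<in> radon_measures"
  shows "translate_measure t \<mu> \<in> hull_of \<mu>"
  unfolding hull_of_def
  using closure_of_subset[of "range (\<lambda>t. translate_measure t \<mu>)" vague_topology]
    orbit_subset_radon[OF assms] by (auto simp: topspace_vague)

lemma self_mem_hull:
  fixes \<mu> :: "('a::{topological_ab_group_add, t2_space} \<Rightarrow> complex) \<Rightarrow> complex"
  assumes "\<mu> \<in> radon_measures"
  shows "\<mu> \<in> hull_of \<mu>"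
  using translate_mem_hull[OF assms, of 0] by (simp add: translate_measure_0[OF assms])

lemma in_hull_iff:
  fixes \<mu> :: "('a::{topological_ab_group_add, t2_space} \<Rightarrow> complex) \<Rightarrow> complex"
  assumes "\<mu> \<in> radon_measures" "\<sigma> \<in> radon_measures"
  shows "\<sigma> \<in> hull_of \<mu> \<longleftrightarrow> (\<forall>F \<epsilon>. finite F \<longrightarrow> F \<subseteq> Cc \<longrightarrow> \<epsilon> > 0 \<longrightarrow>
    (\<exists>t. \<forall>f\<in>F. norm (translate_measure t \<mu> f - \<sigma> f) < \<epsilon>))"
  unfolding hull_of_def
  by (subst in_vague_closure_iff[OF assms(2) orbit_subset_radon[OF assms(1)]]) simp

text \<open>The translation by \<open>t\<close> moves onto the test functions: approximating the
  translate of \<open>y\<close> on \<open>F\<close> is the same as approximating \<open>y\<close> on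
  the functions \<open>f (t + s)\<close>, again finitely many elements of \<open>Cc\<close>.\<close>

lemma hull_invariant:
  fixes \<mu> :: "('a::{topological_ab_group_add, t2_space} \<Rightarrow> complex) \<Rightarrow> complex"
  assumes \<mu>: "\<mu> \<in> radon_measures" and y: "y \<in> hull_of \<mu>"
  shows "translate_measure t y \<in> hull_of \<mu>"
proof -
  have yr: "y \<in> radon_measures" using y hull_subset_radon by blast
  show ?thesis
    unfolding in_hull_iff[OF \<mu> translate_measure_radon[OF yr]]
  proof (intro allI impI)
    fix F :: "('a \<Rightarrow> complex) set" and \<epsilon> :: real
    assume F: "finite F" "F \<subseteq> Cc" and "\<epsilon> > 0"
    let ?F = "(\<lambda>f s. f (t + s)) ` F"
    have "finite ?F" "?F \<subseteq> Cc" using F Cc_translate(1) by auto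
    then obtain x where x: "\<forall>f\<in>?F. norm (translate_measure x \<mu> f - y f) < \<epsilon>"
      using y[unfolded in_hull_iff[OF \<mu> yr]] \<open>\<epsilon> > 0\<close> by presburger
    have "norm (translate_measure (t + x) \<mu> f - translate_measure t y f) < \<epsilon>" if "f \<in> F" for f
    proof -
      have "f \<in> Cc" using that F by blast
      then have "translate_measure x \<mu> (\<lambda>s. f (t + s)) = translate_measure (t + x) \<mu> f"
        by (simp flip: translate_measure_add add: translate_measure_apply)
      then show ?thesis
        using x that \<open>f \<in> Cc\<close> by (auto simp: translate_measure_apply)
    qed
    then show "\<exists>x. \<forall>f\<in>F. norm (translate_measure x \<mu> f - translate_measure t y f) < \<epsilon>"
      by blast
  qed
qed

lemma hull_mono:
  fixes \<mu> :: "('a::{topological_ab_group_add, t2_space} \<Rightarrow> complex) \<Rightarrow> complex"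
  assumes "\<mu> \<in> radon_measures" "y \<in> hull_of \<mu>"
  shows "hull_of y \<subseteq> hull_of \<mu>"
  unfolding hull_of_def[of y]
  by (rule closure_of_minimal) (use hull_invariant[OF assms] closedin_hull in auto)

section \<open>Syndetic approximation\<close>

text \<open>The finite set \<open>E\<close> is fixed before \<open>x\<close>: the set of times at
  which the translates of \<open>\<nu>\<close> are close to \<open>\<sigma>\<close> on
  \<open>F\<close> meets every translate of \<open>E\<close>. This uniformity in \<open>x\<close> is
  what survives in vague limits.\<close>

definition syndetic_approx ::
  "(('a::topological_ab_group_add \<Rightarrow> complex) \<Rightarrow> complex) \<Rightarrow> (('a \<Rightarrow> complex) \<Rightarrow> complex) \<Rightarrow> bool" where
  "syndetic_approx \<nu> \<sigma> \<longleftrightarrow>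
     (\<forall>F \<epsilon>. finite F \<longrightarrow> F \<subseteq> Cc \<longrightarrow> \<epsilon> > 0 \<longrightarrow>
       (\<exists>E. finite E \<and> (\<forall>x. \<exists>e\<in>E. \<forall>f\<in>F. norm (translate_measure (e + x) \<nu> f - \<sigma> f) < \<epsilon>)))"

text \<open>As \<open>E\<close> does not depend on \<open>x\<close>, the finitely many functions
  \<open>f (e + s)\<close> with \<open>e\<close> in \<open>E\<close> can be fixed as tests first.
  Some translate of \<open>\<nu>\<close> by \<open>x\<close> is close to \<open>y\<close> on all of
  them, so whichever \<open>e\<close> belongs to this \<open>x\<close>, translating \<open>y\<close>
  by \<open>e\<close> comes close to \<open>\<sigma>\<close>.\<close>

lemma syndetic_approx_mem_hull:
  fixes \<nu> :: "('a::{topological_ab_group_add, t2_space} \<Rightarrow> complex) \<Rightarrow> complex"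
  assumes "syndetic_approx \<nu> \<sigma>" and \<nu>: "\<nu> \<in> radon_measures" and \<sigma>: "\<sigma> \<in> radon_measures"
    and y: "y \<in> hull_of \<nu>"
  shows "\<sigma> \<in> hull_of y"
proof -
  have yr: "y \<in> radon_measures" using y hull_subset_radon by blast
  show ?thesis
    unfolding in_hull_iff[OF yr \<sigma>]
  proof (intro allI impI)
    fix F :: "('a \<Rightarrow> complex) set" and \<epsilon> :: real
    assume F: "finite F" "F \<subseteq> Cc" and "\<epsilon> > 0"
    then obtain E where E: "finite E"
      "\<And>x. \<exists>e\<in>E. \<forall>f\<in>F. norm (translate_measure (e + x) \<nu> f - \<sigma> f) < \<epsilon> / 2"
      using assms(1)[unfolded syndetic_approx_def, rule_format, of F "\<epsilon> / 2"] by auto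
    let ?F = "(\<lambda>(e, f) s. f (e + s)) ` (E \<times> F)"
    have "finite ?F" "?F \<subseteq> Cc" using F E(1) Cc_translate(1) by auto
    then obtain x where x: "\<forall>f\<in>?F. norm (translate_measure x \<nu> f - y f) < \<epsilon> / 2"
      using y[unfolded in_hull_iff[OF \<nu> yr]] half_gt_zero[OF \<open>\<epsilon> > 0\<close>] by presburger
    obtain e where e: "e \<in> E" "\<forall>f\<in>F. norm (translate_measure (e + x) \<nu> f - \<sigma> f) < \<epsilon> / 2"
      using E(2) by blast
    have "norm (translate_measure e y f - \<sigma> f) < \<epsilon>" if "f \<in> F" for f
    proof -
      have f: "f \<in> Cc" using that F by blast
      then have "translate_measure x \<nu> (\<lambda>s. f (e + s)) = translate_measure (e + x) \<nu> f"
        by (simp flip: translate_measure_add add: translate_measure_apply)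
      moreover have "norm (translate_measure x \<nu> (\<lambda>s. f (e + s)) - y (\<lambda>s. f (e + s))) < \<epsilon> / 2"
        using x e(1) that by auto
      ultimately have "norm (translate_measure (e + x) \<nu> f - translate_measure e y f) < \<epsilon> / 2"
        using f by (simp add: translate_measure_apply)
      with e(2) that show ?thesis
        by (metis norm_minus_commute norm_triangle_half_l)
    qed
    then show "\<exists>t. \<forall>f\<in>F. norm (translate_measure t y f - \<sigma> f) < \<epsilon>"
      by blast
  qed
qed

text \<open>Almost periodicity speaks of convolutions, the vague topology of test functions. For
  \<open>c s = f (- s)\<close> the value \<open>conv c \<nu> x\<close> is that of the translate of
  \<open>\<nu>\<close> by \<open>- x\<close> at \<open>f\<close>, and
  \<open>conv c \<sigma> 0\<close> is \<open>\<sigma> f\<close>; hence the passage from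
  \<open>E\<close> to its negatives.\<close>

lemma syndetic_approxI:
  fixes \<nu> :: "('a::{topological_ab_group_add, t2_space} \<Rightarrow> complex) \<Rightarrow> complex"
  assumes \<sigma>: "\<sigma> \<in> radon_measures"
    and *: "\<And>C \<epsilon>. finite C \<Longrightarrow> C \<subseteq> Cc \<Longrightarrow> \<epsilon> > 0 \<Longrightarrow>
      \<exists>E. finite E \<and> (\<forall>x. \<exists>e\<in>E. \<forall>c\<in>C. norm (conv c \<nu> (x + e) - conv c \<sigma> 0) < \<epsilon>)"
  shows "syndetic_approx \<nu> \<sigma>"
  unfolding syndetic_approx_def
proof (intro allI impI)
  fix F :: "('a \<Rightarrow> complex) set" and \<epsilon> :: real
  assume F: "finite F" "F \<subseteq> Cc" and "\<epsilon> > 0"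
  let ?C = "(\<lambda>f s. f (- s)) ` F"
  have "(\<lambda>s. f (- s)) \<in> Cc" if "f \<in> F" for f
    using Cc_reflect[of f 0] that F(2) by auto
  then have "?C \<subseteq> Cc"
    by (simp add: image_subset_iff)
  then obtain E where E: "finite E"
    "\<And>x. \<exists>e\<in>E. \<forall>c\<in>?C. norm (conv c \<nu> (x + e) - conv c \<sigma> 0) < \<epsilon>"
    using *[of ?C \<epsilon>] F \<open>\<epsilon> > 0\<close> by blast
  have "\<exists>e\<in>uminus ` E. \<forall>f\<in>F. norm (translate_measure (e + x) \<nu> f - \<sigma> f) < \<epsilon>" for x
  proof -
    obtain e where e: "e \<in> E" "\<forall>c\<in>?C. norm (conv c \<nu> (- x + e) - conv c \<sigma> 0) < \<epsilon>"
      using E(2) by blast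
    have "norm (translate_measure (- e + x) \<nu> f - \<sigma> f) < \<epsilon>" if "f \<in> F" for f
    proof -
      have "f \<in> Cc" using that F by blast
      moreover have "(\<lambda>t. f (- (- x + e - t))) = (\<lambda>s. f (- e + x + s))"
        by (simp add: algebra_simps)
      ultimately show ?thesis
        using e(2) that by (force simp: conv_def translate_measure_apply)
    qed
    with e(1) show ?thesis by blast
  qed
  with E(1) show "\<exists>E. finite E \<and>
      (\<forall>x. \<exists>e\<in>E. \<forall>f\<in>F. norm (translate_measure (e + x) \<nu> f - \<sigma> f) < \<epsilon>)"
    by blast
qed

section \<open>Simultaneous almost periods of finitely many Bohr almost periodic functions\<close>

text \<open>The orbits are totally bounded in the sup norm, so up to \<open>\<epsilon>\<close> only
  finitely many tuples of translates occur. Treating the tuple as a whole yields one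
  \<open>e\<close> that serves every \<open>i\<close>.\<close>

lemma bohr_ap_finite_cover:
  fixes S :: "'i \<Rightarrow> 'a::topological_ab_group_add \<Rightarrow> complex"
  assumes I: "finite I" and S: "\<And>i. i \<in> I \<Longrightarrow> bohr_ap (S i)" and "\<epsilon> > 0"
  shows "\<exists>E. finite E \<and> (\<forall>x. \<exists>e\<in>E. \<forall>i\<in>I. norm (S i (x + e) - S i 0) < \<epsilon>)"
proof -
  let ?T = "\<lambda>i t. Bcontfun (translate_fun t (S i))"
  \<comment> \<open>The relative compactness in \<open>bohr_ap\<close> includes that the orbit lies
    in the carrier \<open>Cu\<close>; this is where the translates are seen to be bounded and
    continuous.\<close>
  have trans: "translate_fun t (S i) \<in> Cu" if "i \<in> I" for i t
    using S[OF that] unfolding bohr_ap_def precompactin_def Cu_norm_topology_def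
      topspace_pullback_topology by auto
  have "\<exists>C. finite C \<and> (\<forall>t. \<exists>c\<in>C. dist (?T i t) c < \<epsilon> / 2)" if i: "i \<in> I" for i
  proof -
    let ?R = "range (\<lambda>t. translate_fun t (S i))"
    let ?K = "Cu_norm_topology closure_of ?R"
    have "compactin Cu_norm_topology ?K" "?R \<subseteq> topspace Cu_norm_topology"
      using S[OF i] by (auto simp: bohr_ap_def precompactin_def)
    \<comment> \<open>\<open>Bcontfun\<close> is continuous on \<open>Cu\<close> because the norm
      topology is pulled back along it. The compact image lies in a metric space, where total
      boundedness is available.\<close>
    then have "compactin euclidean (Bcontfun ` ?K)" "?R \<subseteq> ?K"
      using image_compactin[of Cu_norm_topology ?K euclidean Bcontfun]
        continuous_map_pullback[of euclidean euclidean id Cu Bcontfun]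
      by (simp_all add: Cu_norm_topology_def closure_of_subset)
    then have "compact (Bcontfun ` ?K)" and sub: "range (?T i) \<subseteq> Bcontfun ` ?K"
      by auto
    then obtain C where C: "finite C" "Bcontfun ` ?K \<subseteq> (\<Union>c\<in>C. ball c (\<epsilon> / 2))"
      using half_gt_zero[OF \<open>\<epsilon> > 0\<close>] unfolding compact_eq_totally_bounded by metis
    have "range (?T i) \<subseteq> (\<Union>c\<in>C. ball c (\<epsilon> / 2))"
      by (rule order_trans[OF sub C(2)])
    with C(1) show ?thesis
      by (intro exI[of _ C]) (auto simp: image_subset_iff dist_commute)
  qed
  then obtain C where C: "\<And>i. i \<in> I \<Longrightarrow> finite (C i)"
      "\<And>i t. i \<in> I \<Longrightarrow> \<exists>c\<in>C i. dist (?T i t) c < \<epsilon> / 2"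
    by metis
  then obtain \<kappa> where \<kappa>: "\<And>i t. i \<in> I \<Longrightarrow> \<kappa> i t \<in> C i \<and> dist (?T i t) (\<kappa> i t) < \<epsilon> / 2"
    by metis
  \<comment> \<open>Colour \<open>t\<close> by the centres near the translates by \<open>t\<close> and take a representative of each colour.\<close>
  let ?col = "\<lambda>t. \<lambda>i\<in>I. \<kappa> i t"
  have "range ?col \<subseteq> Pi\<^sub>E I C" using \<kappa> by auto
  then have "finite (range ?col)"
    by (rule finite_subset) (rule finite_PiE[OF I C(1)])
  then obtain E where E: "finite E" "range ?col = ?col ` E"
    using finite_subset_image[of "range ?col" ?col UNIV] by auto
  have "\<exists>e\<in>E. \<forall>i\<in>I. norm (S i (x + e) - S i 0) < \<epsilon>" for x
  proof -
    obtain e where e: "e \<in> E" "?col (- x) = ?col e"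
      using E(2) by blast
    have "norm (S i (x + e) - S i 0) < \<epsilon>" if i: "i \<in> I" for i
    proof -
      have "\<kappa> i (- x) = \<kappa> i e"
        using fun_cong[OF e(2), of i] i by simp
      then have "dist (?T i (- x)) (?T i e) < \<epsilon>"
        using \<kappa>[OF i, of "- x"] \<kappa>[OF i, of e] dist_triangle_half_r by (metis dist_commute)
      \<comment> \<open>At the point \<open>e\<close> the two translates take the values
        \<open>S i (x + e)\<close> and \<open>S i 0\<close>.\<close>
      moreover have "dist (apply_bcontfun (?T i (- x)) e) (apply_bcontfun (?T i e) e)
          \<le> dist (?T i (- x)) (?T i e)"
        by (rule dist_bounded)
      moreover have "apply_bcontfun (?T i t) = translate_fun t (S i)" for t
        using trans[OF i, of t] by (intro Bcontfun_inverse) (simp add: Cu_def)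
      ultimately have "dist (translate_fun (- x) (S i) e) (translate_fun e (S i) e) < \<epsilon>"
        by simp
      then show ?thesis
        by (simp add: translate_fun_def dist_norm add.commute)
    qed
    with e(1) show ?thesis by blast
  qed
  with E(1) show ?thesis by blast
qed

section \<open>Smallness of the null part at points of a Foelner set\<close>

lemma Cu_imp_bcontfun: "f \<in> Cu \<Longrightarrow> f \<in> bcontfun"
  by (simp add: Cu_def)

lemma haar_translate_measure:
  assumes "haar_measure \<theta>" "B \<in> sets borel"
  shows "measure \<theta> ((+) x ` B) = measure \<theta> B"
  using assms by (simp add: haar_measure_def measure_def)

text \<open>Markov's inequality for the absolute value of \<open>N\<close> on the translate of
  \<open>A\<close> by \<open>x\<close>, pulled back to \<open>A\<close> by invariance of Haar
  measure. Phrased inside \<open>A\<close>, the exceptional sets for different \<open>x\<close> can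
  be compared in a single set.\<close>

lemma markov_on_translate:
  fixes N :: "'a::{topological_ab_group_add, t2_space} \<Rightarrow> complex"
  assumes \<theta>: "haar_measure \<theta>" and A: "compact A" and N: "N \<in> Cu" and "\<delta> > 0"
    and small: "norm (set_lebesgue_integral \<theta> ((+) x ` A) (\<lambda>x. complex_of_real (norm (N x)))) \<le> \<delta> * m"
  shows "{s \<in> A. norm (N (x + s)) \<ge> \<delta>} \<in> sets borel"
    and "measure \<theta> {s \<in> A. norm (N (x + s)) \<ge> \<delta>} \<le> m"
proof -
  have N': "continuous_on UNIV N" "bounded (range N)"
    using Cu_imp_bcontfun[OF N] by (auto simp: bcontfun_def)
  have sets[simp]: "sets \<theta> = sets borel"
    using \<theta> by (simp add: haar_measure_def)
  have space[simp]: "space \<theta> = UNIV"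
    using sets_eq_imp_space_eq[OF sets] by simp
  have "closed {s. norm (N (x + s)) \<ge> \<delta>}"
    by (intro closed_Collect_le continuous_intros continuous_on_compose2[OF N'(1)]) auto
  then show B: "{s \<in> A. norm (N (x + s)) \<ge> \<delta>} \<in> sets borel"
    using compact_imp_closed[OF A] by (simp add: Collect_conj_eq borel_closed closed_Int)
  let ?A = "(+) x ` A"
  let ?B = "{y \<in> ?A. norm (N y) \<ge> \<delta>}"
  have eq: "?B = (+) x ` {s \<in> A. norm (N (x + s)) \<ge> \<delta>}"
    by auto
  have cA: "compact ?A"
    by (rule compact_continuous_image[OF _ A]) (intro continuous_intros)
  have "closed {y. norm (N y) \<ge> \<delta>}"
    by (intro closed_Collect_le continuous_intros N'(1))
  then have B': "?B \<in> sets borel"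
    using compact_imp_closed[OF cA] by (simp add: Collect_conj_eq borel_closed closed_Int)
  have A': "?A \<in> sets borel"
    using compact_imp_closed[OF cA] by (simp add: borel_closed)
  have finA: "emeasure \<theta> ?A < \<infinity>"
    using \<theta> cA by (auto simp: haar_measure_def)
  obtain M where M: "\<And>y. norm (N y) \<le> M"
    using N'(2) by (auto simp: bounded_iff)
  have meas: "(\<lambda>y. norm (N y)) \<in> borel_measurable \<theta>"
    using borel_measurable_continuous_onI[OF continuous_on_norm[OF N'(1)]]
    by (simp add: measurable_cong_sets[OF sets refl])
  have int: "set_integrable \<theta> ?A (\<lambda>y. norm (N y))"
    unfolding set_integrable_def
    by (rule integrableI_bounded_set_indicator[where B = M]) (use A' finA M meas in auto)
  \<comment> \<open>Finiteness matters: \<open>measure\<close> is 0 by default on sets of infinite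
    measure.\<close>
  have finB: "emeasure \<theta> ?B < \<infinity>"
    using emeasure_mono[of ?B ?A \<theta>] A' finA by (auto simp: less_top[symmetric] top_unique)
  have "\<delta> * measure \<theta> ?B = set_lebesgue_integral \<theta> ?B (\<lambda>_. \<delta>)"
    using B' finB by (simp add: set_lebesgue_integral_def)
  also have "\<dots> \<le> set_lebesgue_integral \<theta> ?A (\<lambda>y. norm (N y))"
    unfolding set_lebesgue_integral_def
  proof (rule integral_mono)
    show "integrable \<theta> (\<lambda>y. indicator ?B y *\<^sub>R \<delta>)"
      using B' finB by simp
    show "integrable \<theta> (\<lambda>y. indicator ?A y *\<^sub>R norm (N y))"
      using int by (simp add: set_integrable_def)
  qed (auto simp: indicator_def)
  also have "\<dots> \<le> norm (set_lebesgue_integral \<theta> ?A (\<lambda>x. complex_of_real (norm (N x))))"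
    by (simp add: set_integral_complex_of_real)
  also have "\<dots> \<le> \<delta> * m"
    by (rule small)
  finally have "measure \<theta> ?B \<le> m"
    using \<open>\<delta> > 0\<close> by simp
  then show "measure \<theta> {s \<in> A. norm (N (x + s)) \<ge> \<delta>} \<le> m"
    unfolding eq using haar_translate_measure[OF \<theta> B] by simp
qed

text \<open>A union bound: for each pair of \<open>e\<close> and \<open>i\<close> the points
  \<open>s\<close> of a Foelner set where the function is not small occupy a small proportion of it,
  so together they cannot exhaust it. The Foelner set itself is the compact set
  \<open>K\<close>.\<close>

lemma null_weakly_ap_small:
  fixes N :: "'i \<Rightarrow> 'a::{topological_ab_group_add, t2_space} \<Rightarrow> complex"
  assumes \<theta>: "haar_measure \<theta>" and A: "folner \<theta> A"
    and I: "finite I" and N: "\<And>i. i \<in> I \<Longrightarrow> null_weakly_ap \<theta> (N i)"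
    and E: "finite E" and "\<delta> > 0"
  shows "\<exists>K. compact K \<and> (\<forall>x. \<exists>s\<in>K. \<forall>e\<in>E. \<forall>i\<in>I. norm (N i (x + e + s)) < \<delta>)"
proof -
  \<comment> \<open>One more than the number of pairs, so that the exceptional sets, each of
    proportion at most \<open>1 / k\<close>, have total proportion below 1. It also keeps
    \<open>k\<close> positive when there are no pairs.\<close>
  define k where "k = card (E \<times> I) + 1"
  have Cu: "N i \<in> Cu" if "i \<in> I" for i
    using N[OF that] by (simp add: null_weakly_ap_def weakly_ap_def)
  let ?J = "\<lambda>i n x. set_lebesgue_integral \<theta> ((+) x ` A n) (\<lambda>x. complex_of_real (norm (N i x)))"
  have "\<forall>\<^sub>F n in sequentially. \<forall>x. norm (?J i n x / complex_of_real (measure \<theta> (A n))) < \<delta> / k"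
    if "i \<in> I" for i
    using N[OF that] A \<open>\<delta> > 0\<close> unfolding null_weakly_ap_def has_mean_def uniform_limit_iff
    by (auto simp: k_def)
  then have "\<forall>\<^sub>F n in sequentially. \<forall>i\<in>I. \<forall>x.
      norm (?J i n x / complex_of_real (measure \<theta> (A n))) < \<delta> / k"
    using I by (simp add: eventually_ball_finite)
  \<comment> \<open>The mean is attained uniformly in the translation, so one \<open>n\<close> works
    for all \<open>x\<close>; this makes \<open>K\<close> independent of \<open>x\<close>.\<close>
  then obtain n where n: "\<And>i x. i \<in> I \<Longrightarrow>
      norm (?J i n x / complex_of_real (measure \<theta> (A n))) < \<delta> / k"
    by (auto simp: eventually_sequentially)
  have An: "compact (A n)" and pos: "measure \<theta> (A n) > 0"
    using A by (auto simp: folner_def)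
  let ?m = "measure \<theta> (A n) / k"
  have J: "norm (?J i n x) \<le> \<delta> * ?m" if "i \<in> I" for i x
    using n[OF that, of x] pos by (simp add: norm_divide field_simps k_def)
  have "\<exists>s\<in>A n. \<forall>e\<in>E. \<forall>i\<in>I. norm (N i (x + e + s)) < \<delta>" for x
  proof (rule ccontr)
    assume neg: "\<not> ?thesis"
    define B where "B = (\<lambda>(e, i). {s \<in> A n. norm (N i (x + e + s)) \<ge> \<delta>})"
    have B: "B p \<in> sets borel" "measure \<theta> (B p) \<le> ?m" if p: "p \<in> E \<times> I" for p
      using markov_on_translate[OF \<theta> An Cu \<open>\<delta> > 0\<close> J, of "snd p" "x + fst p"] p
      by (auto simp: B_def case_prod_unfold)
    have sets[simp]: "sets \<theta> = sets borel"
      using \<theta> by (simp add: haar_measure_def)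
    \<comment> \<open>If no \<open>s\<close> works, every point of the Foelner set is exceptional
      for some pair.\<close>
    have "A n = (\<Union>p\<in>E \<times> I. B p)"
      using neg by (force simp: B_def not_less)
    then have "measure \<theta> (A n) = measure \<theta> (\<Union>p\<in>E \<times> I. B p)"
      by simp
    also have "\<dots> \<le> (\<Sum>p\<in>E \<times> I. measure \<theta> (B p))"
    proof (rule measure_UNION_le)
      show "finite (E \<times> I)" using E I by simp
    qed (use B in auto)
    also have "\<dots> \<le> card (E \<times> I) * ?m"
      using sum_mono[of "E \<times> I" "\<lambda>p. measure \<theta> (B p)" "\<lambda>_. ?m"] B(2) by simp
    also have "\<dots> < measure \<theta> (A n)"
      using pos by (simp add: k_def field_simps)
    finally show False by simp
  qed
  with An show ?thesis by blast
qed

section \<open>From compact to finite sets of shifts, and the approximation for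
  \<open>\<mu>\<close>\<close>

lemma Cu_common_modulus:
  fixes F :: "'i \<Rightarrow> 'a::topological_ab_group_add \<Rightarrow> complex"
  assumes "finite I" "\<And>i. i \<in> I \<Longrightarrow> F i \<in> Cu" "\<epsilon> > 0"
  shows "\<exists>U. open U \<and> 0 \<in> U \<and> (\<forall>i\<in>I. \<forall>x y. x - y \<in> U \<longrightarrow> norm (F i x - F i y) < \<epsilon>)"
proof -
  have "\<forall>i\<in>I. \<exists>U. open U \<and> 0 \<in> U \<and> (\<forall>x y. x - y \<in> U \<longrightarrow> norm (F i x - F i y) < \<epsilon>)"
    using assms by (auto simp: Cu_def)
  then obtain U where U: "\<And>i. i \<in> I \<Longrightarrow> open (U i) \<and> 0 \<in> U i \<and>
      (\<forall>x y. x - y \<in> U i \<longrightarrow> norm (F i x - F i y) < \<epsilon>)"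
    by metis
  show ?thesis
    by (rule exI[of _ "\<Inter>i\<in>I. U i"]) (use U assms(1) in \<open>auto intro!: open_INT\<close>)
qed

lemma compact_cover_translates:
  fixes K :: "'a::topological_ab_group_add set"
  assumes "compact K" "open U" "0 \<in> U"
  shows "\<exists>D. finite D \<and> (\<forall>s\<in>K. \<exists>d\<in>D. s - d \<in> U)"
proof -
  have "open ((\<lambda>s. s - d) -` U)" for d
    by (intro open_vimage assms(2) continuous_intros)
  moreover have "K \<subseteq> (\<Union>d\<in>K. (\<lambda>s. s - d) -` U)"
    using assms(3) by auto
  ultimately obtain D where "D \<subseteq> K" "finite D" "K \<subseteq> (\<Union>d\<in>D. (\<lambda>s. s - d) -` U)"
    by (rule compactE_image[OF assms(1)])
  then show ?thesis by (intro exI[of _ D]) auto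
qed

text \<open>The order of choices is the point. \<open>E\<close> comes from the strongly almost
  periodic part, then \<open>K\<close> is adapted to \<open>E\<close>. Given \<open>x\<close>, first
  \<open>s\<close> in \<open>K\<close> is chosen so that the null part is small at
  \<open>x + e + s\<close> for all \<open>e\<close> in \<open>E\<close>, and only then
  \<open>e\<close>, which depends on \<open>x + s\<close>.\<close>

lemma syndetic_approx_eberlein:
  fixes \<mu> :: "('a::{topological_ab_group_add, t2_space} \<Rightarrow> complex) \<Rightarrow> complex"
  assumes \<theta>: "haar_measure \<theta>" and A: "folner \<theta> A" and \<mu>: "\<mu> \<in> WAP"
    and dec: "eberlein_decomposition \<theta> \<mu> \<mu>\<^sub>s \<mu>\<^sub>0"
  shows "syndetic_approx \<mu> \<mu>\<^sub>s"
proof (rule syndetic_approxI)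
  have s: "\<mu>\<^sub>s \<in> SAP" and z: "\<mu>\<^sub>0 \<in> WAP0 \<theta>" and sum: "\<mu> = radon_add \<mu>\<^sub>s \<mu>\<^sub>0"
    using dec by (auto simp: eberlein_decomposition_def)
  show "\<mu>\<^sub>s \<in> radon_measures"
    using s by (simp add: SAP_def translation_bounded_def)
  fix C :: "('a \<Rightarrow> complex) set" and \<epsilon> :: real
  assume C: "finite C" "C \<subseteq> Cc" and "\<epsilon> > 0"
  define \<delta> where "\<delta> = \<epsilon> / 3"
  have "\<delta> > 0" using \<open>\<epsilon> > 0\<close> by (simp add: \<delta>_def)
  obtain E where E: "finite E"
      "\<And>x. \<exists>e\<in>E. \<forall>c\<in>C. norm (conv c \<mu>\<^sub>s (x + e) - conv c \<mu>\<^sub>s 0) < \<delta>"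
    using bohr_ap_finite_cover[of C "\<lambda>c. conv c \<mu>\<^sub>s" \<delta>] C s \<open>\<delta> > 0\<close> by (auto simp: SAP_def)
  have null: "null_weakly_ap \<theta> (conv c \<mu>\<^sub>0)" if "c \<in> C" for c
    using that C z by (auto simp: WAP0_def)
  obtain K where K: "compact K"
      "\<And>x. \<exists>s\<in>K. \<forall>e\<in>E. \<forall>c\<in>C. norm (conv c \<mu>\<^sub>0 (x + e + s)) < \<delta>"
    using null_weakly_ap_small[where N = "\<lambda>c. conv c \<mu>\<^sub>0", OF \<theta> A C(1) null E(1) \<open>\<delta> > 0\<close>]
    by metis
  have Cu: "conv c \<mu> \<in> Cu" if "c \<in> C" for c
    using that C \<mu> by (auto simp: WAP_def weakly_ap_def)
  \<comment> \<open>Uniform continuity is used for the convolution with the whole measure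
    \<open>\<mu>\<close>, so replacing \<open>s\<close> by a nearby \<open>d\<close> in a finite set
    costs a single error term.\<close>
  obtain U where U: "open U" "0 \<in> U"
      "\<And>c x y. c \<in> C \<Longrightarrow> x - y \<in> U \<Longrightarrow> norm (conv c \<mu> x - conv c \<mu> y) < \<delta>"
    using Cu_common_modulus[where F = "\<lambda>c. conv c \<mu>", OF C(1) Cu \<open>\<delta> > 0\<close>] by metis
  obtain D where D: "finite D" "\<And>s. s \<in> K \<Longrightarrow> \<exists>d\<in>D. s - d \<in> U"
    using compact_cover_translates[OF K(1) U(1,2)] by blast
  have conv_sum: "conv c \<mu> x = conv c \<mu>\<^sub>s x + conv c \<mu>\<^sub>0 x" if "c \<in> C" for c x
    unfolding conv_def sum radon_add_def using Cc_reflect[of c x] that C by auto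
  have "\<exists>p\<in>(\<lambda>(d, e). d + e) ` (D \<times> E). \<forall>c\<in>C. norm (conv c \<mu> (x + p) - conv c \<mu>\<^sub>s 0) < \<epsilon>" for x
  proof -
    obtain s where s: "s \<in> K" "\<And>e c. e \<in> E \<Longrightarrow> c \<in> C \<Longrightarrow> norm (conv c \<mu>\<^sub>0 (x + e + s)) < \<delta>"
      using K(2) by metis
    obtain d where d: "d \<in> D" "s - d \<in> U"
      using D(2) s(1) by blast
    obtain e where e: "e \<in> E" "\<And>c. c \<in> C \<Longrightarrow> norm (conv c \<mu>\<^sub>s (x + s + e) - conv c \<mu>\<^sub>s 0) < \<delta>"
      using E(2) by metis
    have "norm (conv c \<mu> (x + (d + e)) - conv c \<mu>\<^sub>s 0) < \<epsilon>" if c: "c \<in> C" for c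
    proof -
      \<comment> \<open>Three errors below \<open>\<epsilon> / 3\<close>: \<open>?a\<close> from the
        almost period \<open>e\<close>, the null part at \<open>x + s + e\<close>, and
        \<open>?u\<close> from replacing \<open>s\<close> by \<open>d\<close>.\<close>
      let ?a = "conv c \<mu>\<^sub>s (x + s + e) - conv c \<mu>\<^sub>s 0"
      let ?u = "conv c \<mu> (x + s + e) - conv c \<mu> (x + (d + e))"
      have "conv c \<mu> (x + (d + e)) - conv c \<mu>\<^sub>s 0 = ?a + conv c \<mu>\<^sub>0 (x + s + e) - ?u"
        using conv_sum[OF c, of "x + s + e"] by simp
      then have "norm (conv c \<mu> (x + (d + e)) - conv c \<mu>\<^sub>s 0)
          \<le> norm ?a + norm (conv c \<mu>\<^sub>0 (x + s + e)) + norm ?u"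
        using order_trans[OF norm_triangle_ineq4 add_right_mono[OF norm_triangle_ineq]] by metis
      moreover have "norm ?a < \<delta>"
        by (rule e(2)[OF c])
      moreover have "norm (conv c \<mu>\<^sub>0 (x + s + e)) < \<delta>"
        using s(2)[OF e(1) c] by (simp add: algebra_simps)
      moreover have "norm ?u < \<delta>"
        using U(3)[OF c, of "x + s + e" "x + (d + e)"] d(2) by (simp add: algebra_simps)
      ultimately show ?thesis
        unfolding \<delta>_def by linarith
    qed
    with d(1) e(1) show ?thesis by (intro bexI[of _ "d + e"]) auto
  qed
  moreover have "finite ((\<lambda>(d, e). d + e) ` (D \<times> E))"
    using D(1) E(1) by simp
  ultimately show "\<exists>E. finite E \<and> (\<forall>x. \<exists>e\<in>E. \<forall>c\<in>C. norm (conv c \<mu> (x + e) - conv c \<mu>\<^sub>s 0) < \<epsilon>)"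
    by blast
qed

section \<open>Minimality and uniqueness\<close>

theorem corollary3p16:
  fixes \<theta> :: "'a::{topological_ab_group_add, t2_space} measure"
    and \<mu> \<mu>\<^sub>s \<mu>\<^sub>0 :: "('a \<Rightarrow> complex) \<Rightarrow> complex"
  assumes "locally_compact_space (euclidean :: 'a topology)"
    and "haar_measure \<theta>"
    and "\<exists>A. folner \<theta> A"
    and "\<mu> \<in> WAP"
    and "eberlein_decomposition \<theta> \<mu> \<mu>\<^sub>s \<mu>\<^sub>0"
  shows "minimal_component (subtopology vague_topology (hull_of \<mu>)) translate_measure (hull_of \<mu>\<^sub>s) \<and>
         (\<forall>Y. minimal_component (subtopology vague_topology (hull_of \<mu>)) translate_measure Y
              \<longrightarrow> Y = hull_of \<mu>\<^sub>s)"
proof -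
  have s: "\<mu>\<^sub>s \<in> SAP"
    using assms(5) by (simp add: eberlein_decomposition_def)
  have rs: "\<mu>\<^sub>s \<in> radon_measures" and r: "\<mu> \<in> radon_measures"
    using s assms(4) by (auto simp: SAP_def WAP_def translation_bounded_def)
  have syn: "syndetic_approx \<mu> \<mu>\<^sub>s"
    using syndetic_approx_eberlein assms(2-5) by blast
  \<comment> \<open>Every orbit closure in the hull of \<open>\<mu>\<close> contains
    \<open>\<mu>\<^sub>s\<close>, hence its whole hull. Both minimality and uniqueness follow from
    this.\<close>
  have orbit: "hull_of \<mu>\<^sub>s \<subseteq> hull_of y" if "y \<in> hull_of \<mu>" for y
    using hull_mono syndetic_approx_mem_hull[OF syn r rs that] hull_subset_radon that by blast
  have sub: "hull_of \<mu>\<^sub>s \<subseteq> hull_of \<mu>"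
    using orbit self_mem_hull[OF r] by blast
  \<comment> \<open>Density of orbits is stated for a twice relativised topology; this identity
    brings it back to hulls in the vague topology.\<close>
  have eq: "subtopology (subtopology vague_topology (hull_of \<mu>)) Y closure_of
      range (\<lambda>t. translate_measure t y) = Y \<inter> hull_of y"
    if "Y \<subseteq> hull_of \<mu>" "\<forall>t. translate_measure t y \<in> Y" for Y y
  proof -
    have "hull_of \<mu> \<inter> Y = Y" "Y \<inter> range (\<lambda>t. translate_measure t y) = range (\<lambda>t. translate_measure t y)"
      using that by auto
    then show ?thesis
      by (simp add: subtopology_subtopology closure_of_subtopology hull_of_def)
  qed
  have "minimal_component (subtopology vague_topology (hull_of \<mu>)) translate_measure (hull_of \<mu>\<^sub>s)"
    unfolding minimal_component_def
  proof (intro conjI ballI allI)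
    show "hull_of \<mu>\<^sub>s \<noteq> {}"
      using self_mem_hull[OF rs] by blast
    show "closedin (subtopology vague_topology (hull_of \<mu>)) (hull_of \<mu>\<^sub>s)"
      using closedin_hull sub by (metis closedin_subset_topspace)
    fix y assume y: "y \<in> hull_of \<mu>\<^sub>s"
    show inv: "translate_measure t y \<in> hull_of \<mu>\<^sub>s" for t
      by (rule hull_invariant[OF rs y])
    have "hull_of \<mu>\<^sub>s \<subseteq> hull_of y"
      using orbit y sub by blast
    then show "subtopology (subtopology vague_topology (hull_of \<mu>)) (hull_of \<mu>\<^sub>s) closure_of
        range (\<lambda>t. translate_measure t y) = hull_of \<mu>\<^sub>s"
      using eq[OF sub, of y] inv by blast
  qed
  moreover have "Y = hull_of \<mu>\<^sub>s"
    if "minimal_component (subtopology vague_topology (hull_of \<mu>)) translate_measure Y" for Y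
  proof -
    have Y: "Y \<noteq> {}" "closedin vague_topology Y" "Y \<subseteq> hull_of \<mu>"
        "\<And>t y. y \<in> Y \<Longrightarrow> translate_measure t y \<in> Y"
        "\<And>y. y \<in> Y \<Longrightarrow> subtopology (subtopology vague_topology (hull_of \<mu>)) Y closure_of
          range (\<lambda>t. translate_measure t y) = Y"
      using that closedin_trans_full[OF _ closedin_hull] closedin_imp_subset
      unfolding minimal_component_def by blast+
    \<comment> \<open>A closed invariant set contains the hull of each of its points, so
      \<open>Y\<close> contains \<open>\<mu>\<^sub>s\<close>. Then the hull of
      \<open>\<mu>\<^sub>s\<close> lies in \<open>Y\<close>, and density of the orbit of
      \<open>\<mu>\<^sub>s\<close> in \<open>Y\<close> gives the other inclusion.\<close>
    have hull: "hull_of y \<subseteq> Y" if "y \<in> Y" for y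
      unfolding hull_of_def by (rule closure_of_minimal) (use Y that in auto)
    obtain y where "y \<in> Y" using Y(1) by blast
    then have "\<mu>\<^sub>s \<in> Y"
      using orbit hull Y(3) self_mem_hull[OF rs] by blast
    then show ?thesis
      using eq[OF Y(3), of \<mu>\<^sub>s] Y(4,5) hull by blast
  qed
  ultimately show ?thesis by blast
qed

end
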